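(* For every $M>0$ there is a constant $C=C(M)>0$, depending only on $M$, with the following property. Let $D\subset\mathbb{C}$ be a domain containing $0$, and suppose that there exists a sequence $z_j\in\mathbb{C}\setminus D$, $j\in\mathbb{N}$, such that, with $r_j=|z_j|$: (i) the sequence $(r_j)$ is strictly increasing to infinity; (ii) $\frac{r_{j+1}}{r_j}\le M$ for all $j$. Then $b(D)\ge C>0$.
   Context: A domain is a nonempty connected open subset of $\mathbb{C}$. Let $\mathbb{D}$ be the open unit disk, and for a domain $D\subset\mathbb{C}$ let $\mathrm{Hol}(\mathbb{D},D)$ be the set of holomorphic functions $f:\mathbb{D}\to D$. For $p>0$ and $\alpha>-1$, the weighted Bergman space $A^p_\alpha$ is the set of holomorphic $f$ on $\mathbb{D}$ with $\int_{\mathbb{D}}|f(z)|^p(1-|z|)^\alpha\,dA(z)<+\infty$, where $dA$ is Lebesgue area measure. The Bergman number of a holomorphic function $f$ on $\mathbb{D}$ is $b(f):=\sup\left(\left\{\frac{p}{\alpha+2}: p>0,\ \alpha>-1,\ f\in A^p_\alpha\right\}\cup\{0\}\right)\in[0,+\infty]$. The Bergman number of a domain $D$ is $b(D):=\inf\{b(f): f\in\mathrm{Hol}(\mathbb{D},D)\}\in[0,+\infty]$. *)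

theory Defs
  imports "HOL-Complex_Analysis.Complex_Analysis"
begin

abbreviation unit_disk :: "complex set" where
  "unit_disk \<equiv> ball 0 1"

definition complex_domain :: "complex set \<Rightarrow> bool" where
  "complex_domain D \<longleftrightarrow> D \<noteq> {} \<and> open D \<and> connected D"

text \<open>
  Functions on the unit disk are represented by total functions on the complex plane; their
  values outside the disk play no role in any of the definitions below.
\<close>

definition Hol :: "complex set \<Rightarrow> complex set \<Rightarrow> (complex \<Rightarrow> complex) set" where
  "Hol U D = {f. f holomorphic_on U \<and> f ` U \<subseteq> D}"

definition weighted_bergman_space :: "real \<Rightarrow> real \<Rightarrow> (complex \<Rightarrow> complex) set" where
  "weighted_bergman_space p \<alpha> =
     {f. f holomorphic_on unit_disk \<and>
         (\<integral>\<^sup>+z\<in>unit_disk. ennreal (norm (f z) powr p * (1 - norm z) powr \<alpha>) \<partial>lborel) < \<infinity>}"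

definition bergman_number :: "(complex \<Rightarrow> complex) \<Rightarrow> ennreal" where
  "bergman_number f =
     Sup ({ennreal (p / (\<alpha> + 2)) | p \<alpha>. p > 0 \<and> \<alpha> > -1 \<and> f \<in> weighted_bergman_space p \<alpha>} \<union> {0})"

definition domain_bergman_number :: "complex set \<Rightarrow> ennreal" where
  "domain_bergman_number D = Inf (bergman_number ` Hol unit_disk D)"

end

theory Submission
  imports Defs
begin

text \<open>
  By Schottky's theorem, rescaled to the disk of radius \<open>1 - |a|\<close> about \<open>a\<close>, a function that omits two
  values whose moduli and mutual distance are comparable with \<open>R\<close> and that satisfies \<open>|f a| \<le> R\<close> obeys
  \<open>|f| \<le> K R\<close> on the disk of radius \<open>(1 - |a|) / 2\<close> about \<open>a\<close>. Here \<open>K\<close> depends only on \<open>M\<close>, since the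
  omitted sequence meets every annulus \<open>R < |w| \<le> M R\<close> with \<open>R \<ge> r\<^sub>0\<close>. Each halving of the distance to
  the unit circle thus multiplies the bound for \<open>|f|\<close> by \<open>K\<close>, so that \<open>|f z|\<close> is at most a
  constant times \<open>(1 - |z|) powr (- log 2 K)\<close>, which puts \<open>f\<close> into the Bergman space with
  \<open>\<alpha> = 1\<close> and \<open>p = 1 / log 2 K\<close>.
\<close>

text \<open>The exponential is Schottky's bound for a function that omits 0 and 1. The factor
  \<open>2 * M\<^sup>2 + M\<close> bounds the distance of two omitted values in units of
  \<open>R\<close>, and the final \<open>M\<close> pays for recentring from an omitted value at
  0.\<close>

definition schottky_const :: "real \<Rightarrow> real" where
  "schottky_const M = exp (pi * exp (pi * 30)) * (2 * M\<^sup>2 + M) + M"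

lemma schottky_const_gt_1:
  assumes "M \<ge> 1"
  shows "schottky_const M > 1"
proof -
  have "exp (pi * exp (pi * 30)) * (2 * M\<^sup>2 + M) > 0"
    using assms by (intro mult_pos_pos add_pos_pos) auto
  then show ?thesis
    using assms by (simp add: schottky_const_def)
qed

text \<open>An affine map in the range sends \<open>p\<close>, \<open>q\<close> to 0, 1, and one in
  the domain moves a disk about \<open>a\<close> to the unit disk.\<close>

lemma Schottky_omitting_two_values:
  assumes holf: "f holomorphic_on ball 0 1"
    and a: "norm a < 1"
    and omit: "\<And>z. norm z < 1 \<Longrightarrow> f z \<noteq> p \<and> f z \<noteq> q"
    and "p \<noteq> q"
    and fa: "norm (f a - p) \<le> 2 * norm (q - p)"
    and z: "norm (z - a) \<le> (1 - norm a) / 2"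
  shows "norm (f z - p) \<le> exp (pi * exp (pi * 30)) * norm (q - p)"
proof -
  \<comment> \<open>The factor lies strictly between 1/2 and 1: the closed disk of radius
    \<open>s\<close> about \<open>a\<close> stays in the unit disk, and \<open>z\<close> gets
    relative distance at most 2/3 from its centre.\<close>
  define s where "s = 3 / 4 * (1 - norm a)"
  have "s > 0"
    using a by (simp add: s_def)
  define h where "h u = a + of_real s * u" for u :: complex
  have h_disk: "norm (h u) < 1" if "norm u \<le> 1" for u
  proof -
    have "norm (h u) \<le> norm a + s * norm u"
      using norm_triangle_ineq[of a "of_real s * u"] \<open>s > 0\<close> by (simp add: h_def norm_mult)
    also have "\<dots> \<le> norm a + s * 1"
      using that \<open>s > 0\<close> by (intro add_left_mono mult_left_mono) auto
    also have "\<dots> < 1"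
      using a by (simp add: s_def field_simps)
    finally show ?thesis .
  qed
  define g where "g u = (f (h u) - p) / (q - p)" for u
  have "h holomorphic_on cball 0 1"
    unfolding h_def by (intro holomorphic_intros)
  then have "(f \<circ> h) holomorphic_on cball 0 1"
    by (rule holomorphic_on_compose_gen[OF _ holf]) (use h_disk in auto)
  then have holg: "g holomorphic_on cball 0 1"
    unfolding g_def o_def using \<open>p \<noteq> q\<close> by (intro holomorphic_intros) auto
  have g0: "norm (g 0) \<le> 2"
    using fa \<open>p \<noteq> q\<close> by (simp add: g_def h_def norm_divide field_simps)
  have g_omit: "\<not> (g u = 0 \<or> g u = 1)" if "u \<in> cball 0 1" for u
    using omit[OF h_disk[of u]] that \<open>p \<noteq> q\<close> by (auto simp: g_def)
  define u where "u = (z - a) / of_real s"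
  have "norm u = norm (z - a) / s"
    using \<open>s > 0\<close> by (simp add: u_def norm_divide)
  then have u: "norm u \<le> 2 / 3"
    using z \<open>s > 0\<close> by (simp add: pos_divide_le_eq) (simp add: s_def)
  \<comment> \<open>With \<open>norm (g 0) \<le> 2\<close> and radius 2/3, the inner factor is 2 + 4
    + 24 = 30.\<close>
  have "norm (g u) \<le> exp (pi * exp (pi * (2 + 2 * 2 + 12 * (2 / 3) / (1 - 2 / 3))))"
    by (rule Schottky[OF holg g0 g_omit]) (use u in auto)
  moreover have "h u = z"
    using \<open>s > 0\<close> by (simp add: h_def u_def)
  ultimately show ?thesis
    using \<open>p \<noteq> q\<close> by (simp add: g_def norm_divide field_simps)
qed

locale omitted_sequence =
  fixes M :: real and w :: "nat \<Rightarrow> complex" and f :: "complex \<Rightarrow> complex"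
  assumes M_ge_1: "M \<ge> 1"
    and w_nonzero: "w 0 \<noteq> 0"
    and w_tendsto: "filterlim (\<lambda>j. norm (w j)) at_top sequentially"
    and w_ratio: "norm (w (Suc j)) \<le> M * norm (w j)"
    and hol: "f holomorphic_on ball 0 1"
    and omits: "norm z < 1 \<Longrightarrow> f z \<noteq> w j"
begin

text \<open>The first term of modulus above \<open>R\<close> is not \<open>w 0\<close>, so its
  predecessor has modulus at most \<open>R\<close> and the ratio bound applies.\<close>

lemma ex_in_annulus:
  assumes "norm (w 0) \<le> R"
  obtains j where "R < norm (w j)" "norm (w j) \<le> M * R"
proof -
  obtain n where n: "R < norm (w n)"
    using w_tendsto by (metis eventually_sequentially filterlim_at_top_dense order_refl)
  define j where "j = (LEAST j. R < norm (w j))"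
  have j: "R < norm (w j)"
    unfolding j_def using n by (rule LeastI)
  then obtain i where i: "j = Suc i"
    using assms by (cases j) auto
  then have "norm (w i) \<le> R"
    using not_less_Least[of i "\<lambda>j. R < norm (w j)"] by (simp add: j_def)
  then have "M * norm (w i) \<le> M * R"
    using M_ge_1 by (intro mult_left_mono) auto
  then have "norm (w j) \<le> M * R"
    using w_ratio[of i] i by simp
  with j show thesis
    by (rule that)
qed

lemma local_growth:
  assumes R: "norm (w 0) \<le> R" "norm (f a) \<le> R"
    and a: "norm a < 1"
    and z: "norm (z - a) \<le> (1 - norm a) / 2"
  shows "norm (f z) \<le> schottky_const M * R"
proof -
  let ?S = "exp (pi * exp (pi * 30))"
  have "R > 0"
    using R(1) w_nonzero by (smt (verit) zero_less_norm_iff)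
  then have MR: "R \<le> M * R"
    using M_ge_1 by simp
  obtain i where i: "R < norm (w i)" "norm (w i) \<le> M * R"
    using ex_in_annulus[OF R(1)] .
  have "norm (w 0) \<le> 2 * M * R"
    using R(1) MR \<open>R > 0\<close> by linarith
  \<comment> \<open>Starting from \<open>2 * M * R\<close>, twice the bound for
    \<open>norm (w i)\<close>, separates the two omitted values by at least
    \<open>M * R\<close>.\<close>
  then obtain j where j: "2 * M * R < norm (w j)" "norm (w j) \<le> M * (2 * M * R)"
    by (rule ex_in_annulus)
  have lower: "M * R \<le> norm (w j - w i)"
    using norm_triangle_ineq2[of "w j" "w i"] i j by simp
  have upper: "norm (w j - w i) \<le> (2 * M\<^sup>2 + M) * R"
    using norm_triangle_ineq4[of "w j" "w i"] i j by (simp add: power2_eq_square algebra_simps)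
  have "norm (f a - w i) \<le> 2 * norm (w j - w i)"
    using norm_triangle_ineq4[of "f a" "w i"] R(2) MR lower i by simp
  moreover have "w i \<noteq> w j"
    using lower less_le_trans[OF \<open>R > 0\<close> MR] by auto
  ultimately have "norm (f z - w i) \<le> ?S * norm (w j - w i)"
    using Schottky_omitting_two_values[OF hol a _ _ _ z] omits by blast
  also have "\<dots> \<le> ?S * ((2 * M\<^sup>2 + M) * R)"
    using upper by simp
  finally have "norm (f z) \<le> ?S * ((2 * M\<^sup>2 + M) * R) + M * R"
    using norm_triangle_ineq2[of "f z" "w i"] i by simp
  then show ?thesis
    by (simp add: schottky_const_def algebra_simps)
qed

text \<open>The maximum with \<open>norm (w 0)\<close> keeps every bound of the induction below in
  the range where \<open>local_growth\<close> applies.\<close>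

definition base_bound :: real where
  "base_bound = max (norm (f 0)) (norm (w 0))"

lemma dyadic_growth:
  assumes "norm z \<le> 1 - (1 / 2) ^ n"
  shows "norm (f z) \<le> schottky_const M ^ n * base_bound"
  using assms
proof (induction n arbitrary: z)
  case 0
  then show ?case
    by (simp add: base_bound_def)
next
  case (Suc n)
  let ?K = "schottky_const M"
  define t where "t = (1 - (1 / 2) ^ n :: real)"
  \<comment> \<open>The radial projection of \<open>z\<close> to the closed disk of radius
    \<open>t\<close>; for \<open>norm z > t\<close> it moves \<open>z\<close> by
    \<open>norm z - t\<close>, at most half of \<open>1 - t\<close>.\<close>
  define a where "a = (if norm z \<le> t then z else of_real (t / norm z) * z)"
  have t: "0 \<le> t" "t < 1"
    by (auto simp: t_def power_le_one)
  have a_le: "norm a \<le> t"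
    using t by (auto simp: a_def norm_mult norm_divide)
  have "(1 / 2) ^ Suc n = (1 - t) / 2"
    by (simp add: t_def)
  then have "norm z \<le> 1 - (1 - t) / 2"
    using Suc.prems by (simp only:)
  then have z_t: "norm z - t \<le> (1 - t) / 2"
    by (simp add: field_simps)
  have "norm (z - a) \<le> (1 - norm a) / 2"
  proof (cases "norm z \<le> t")
    case True
    then show ?thesis
      using t by (simp add: a_def)
  next
    case False
    then have "norm z > 0"
      using t by linarith
    have "z - a = of_real (1 - t / norm z) * z"
      using False by (simp add: a_def algebra_simps)
    then have "norm (z - a) = \<bar>1 - t / norm z\<bar> * norm z"
      by (simp only: norm_mult norm_of_real)
    also have "\<dots> = norm z - t"
      using False \<open>norm z > 0\<close> by (simp add: abs_if field_simps)
    finally show ?thesis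
      using z_t a_le by simp
  qed
  moreover have "norm (f a) \<le> ?K ^ n * base_bound"
    using Suc.IH[of a] a_le by (simp add: t_def)
  moreover have "norm (w 0) \<le> ?K ^ n * base_bound"
  proof -
    have "1 * base_bound \<le> ?K ^ n * base_bound"
      using schottky_const_gt_1[OF M_ge_1]
      by (intro mult_right_mono) (auto simp: base_bound_def le_max_iff_disj)
    then show ?thesis
      by (simp add: base_bound_def)
  qed
  moreover have "norm a < 1"
    using a_le t by simp
  ultimately have "norm (f z) \<le> ?K * (?K ^ n * base_bound)"
    by (intro local_growth)
  then show ?case
    by (simp add: mult_ac)
qed

text \<open>For the least \<open>n\<close> with \<open>(1 / 2) ^ n \<le> d\<close>, \<open>d\<close>
  is also at most twice that power. Since \<open>2 powr log 2 K = K\<close>, the weight is at most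
  \<open>K / K ^ n\<close>, which cancels the dyadic growth.\<close>

lemma polynomial_growth:
  assumes "norm z < 1"
  shows "norm (f z) * (1 - norm z) powr log 2 (schottky_const M) \<le> schottky_const M * base_bound"
proof -
  define K where "K = schottky_const M"
  have K: "K > 1"
    unfolding K_def using M_ge_1 by (rule schottky_const_gt_1)
  define d where "d = 1 - norm z"
  have d: "0 < d" "d \<le> 1"
    using assms by (auto simp: d_def)
  define n where "n = (LEAST n. (1 / 2) ^ n \<le> d)"
  have "\<exists>n. (1 / 2) ^ n \<le> d"
    using real_arch_pow_inv[of d "1 / 2"] d by (auto intro: less_imp_le)
  then have n: "(1 / 2) ^ n \<le> d"
    unfolding n_def by (rule LeastI_ex)
  then have fz: "norm (f z) \<le> K ^ n * base_bound"
    unfolding K_def by (intro dyadic_growth) (simp add: d_def)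
  have "d \<le> 2 * (1 / 2) ^ n"
  proof (cases n)
    case 0
    then show ?thesis
      using d by simp
  next
    case (Suc m)
    then have "\<not> (1 / 2) ^ m \<le> d"
      using not_less_Least[of m "\<lambda>n. (1 / 2) ^ n \<le> d"] by (simp add: n_def)
    then show ?thesis
      using Suc by simp
  qed
  also have "\<dots> = 2 powr (1 - real n)"
    by (simp add: powr_diff powr_realpow power_one_over)
  finally have "d powr log 2 K \<le> (2 powr (1 - real n)) powr log 2 K"
    using d K by (intro powr_mono2) auto
  also have "\<dots> = (2 powr log 2 K) powr (1 - real n)"
    by (simp add: powr_powr mult.commute)
  also have "\<dots> = K / K ^ n"
    using K by (simp add: powr_diff powr_realpow)
  finally have "norm (f z) * d powr log 2 K \<le> (K ^ n * base_bound) * (K / K ^ n)"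
    using fz by (intro mult_mono) (use order_trans[OF norm_ge_zero fz] in auto)
  also have "\<dots> = K * base_bound"
    using K by simp
  finally show ?thesis
    by (simp add: K_def d_def)
qed

text \<open>The choice of \<open>p\<close> turns the exponent of \<open>1 - norm z\<close> in
  \<open>polynomial_growth\<close> into 1, so the integrand is bounded on a set of finite
  area.\<close>

lemma in_weighted_bergman_space:
  "f \<in> weighted_bergman_space (1 / log 2 (schottky_const M)) 1"
proof -
  define N where "N = log 2 (schottky_const M)"
  have N: "N > 0"
    unfolding N_def using schottky_const_gt_1[OF M_ge_1] by simp
  define B where "B = (schottky_const M * base_bound) powr (1 / N)"
  have bound: "norm (f z) powr (1 / N) * (1 - norm z) powr 1 \<le> B" if "norm z < 1" for z
  proof -
    have "norm (f z) powr (1 / N) * (1 - norm z) powr 1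
        = (norm (f z) * (1 - norm z) powr N) powr (1 / N)"
      using that N by (simp add: powr_mult powr_powr)
    also have "\<dots> \<le> B"
      unfolding B_def N_def
      by (intro powr_mono2 polynomial_growth that) (use N that in \<open>auto simp: N_def\<close>)
    finally show ?thesis .
  qed
  have "(\<integral>\<^sup>+z\<in>unit_disk. ennreal (norm (f z) powr (1 / N) * (1 - norm z) powr 1) \<partial>lborel)
      \<le> (\<integral>\<^sup>+z. ennreal B * indicator unit_disk z \<partial>lborel)"
    by (intro nn_integral_mono) (use bound in \<open>auto simp: indicator_def intro!: ennreal_leI\<close>)
  also have "\<dots> = ennreal B * emeasure lborel unit_disk"
    by (intro nn_integral_cmult_indicator) auto
  also have "\<dots> < \<infinity>"
    using emeasure_lborel_ball_finite[of "0 :: complex" 1] by (simp add: ennreal_mult_less_top)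
  finally show ?thesis
    using hol by (simp add: weighted_bergman_space_def N_def)
qed

lemma bergman_number_ge:
  "bergman_number f \<ge> ennreal (1 / (3 * log 2 (schottky_const M)))"
  unfolding bergman_number_def
proof (rule Sup_upper, rule UnI1)
  let ?p = "1 / log 2 (schottky_const M)"
  have "?p > 0"
    using schottky_const_gt_1[OF M_ge_1] by simp
  moreover have "1 / (3 * log 2 (schottky_const M)) = ?p / (1 + 2)"
    by simp
  ultimately show "ennreal (1 / (3 * log 2 (schottky_const M)))
      \<in> {ennreal (p / (\<alpha> + 2)) |p \<alpha>. 0 < p \<and> - 1 < \<alpha> \<and> f \<in> weighted_bergman_space p \<alpha>}"
    using in_weighted_bergman_space unfolding mem_Collect_eq
    by (intro exI[of _ ?p] exI[of _ 1]) simp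
qed

end

theorem theorem1p2:
  fixes M :: real
  assumes "M > 0"
  shows "\<exists>C::real. C > 0 \<and>
    (\<forall>D :: complex set.
       complex_domain D \<and> 0 \<in> D \<and>
       (\<exists>z :: nat \<Rightarrow> complex.
          (\<forall>j. z j \<in> - D) \<and>
          strict_mono (\<lambda>j. norm (z j)) \<and>
          filterlim (\<lambda>j. norm (z j)) at_top sequentially \<and>
          (\<forall>j. norm (z (Suc j)) / norm (z j) \<le> M))
       \<longrightarrow> domain_bergman_number D \<ge> ennreal C)"
proof -
  \<comment> \<open>The locale needs a ratio bound of at least 1; enlarging \<open>M\<close>
    preserves the ratio condition, and \<open>C\<close> still depends on \<open>M\<close>
    alone.\<close>
  define L where "L = max M 1"
  define C where "C = 1 / (3 * log 2 (schottky_const L))"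
  have "C > 0"
    using schottky_const_gt_1[of L] by (simp add: C_def L_def)
  moreover have "ennreal C \<le> domain_bergman_number D"
    if "0 \<in> D" and omit: "\<And>j. z j \<in> - D"
      and lim: "filterlim (\<lambda>j. norm (z j)) at_top sequentially"
      and ratio: "\<And>j. norm (z (Suc j)) / norm (z j) \<le> M"
    for D and z :: "nat \<Rightarrow> complex"
    unfolding domain_bergman_number_def
  proof (rule INF_greatest)
    fix f assume "f \<in> Hol unit_disk D"
    then have f: "f holomorphic_on ball 0 1" "\<And>x. norm x < 1 \<Longrightarrow> f x \<in> D"
      by (auto simp: Hol_def)
    \<comment> \<open>This is where \<open>0 \<in> D\<close> enters: the quotients in
      \<open>ratio\<close> are genuine and can be multiplied out.\<close>
    have nz: "z j \<noteq> 0" for j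
      using omit[of j] \<open>0 \<in> D\<close> by auto
    have "norm (z (Suc j)) \<le> L * norm (z j)" for j
    proof -
      have "norm (z (Suc j)) \<le> M * norm (z j)"
        using ratio[of j] nz[of j] by (simp add: field_simps)
      also have "\<dots> \<le> L * norm (z j)"
        by (intro mult_right_mono) (auto simp: L_def)
      finally show ?thesis .
    qed
    then interpret omitted_sequence L z f
      using f nz lim omit by unfold_locales (auto simp: L_def, metis)
    show "ennreal C \<le> bergman_number f"
      unfolding C_def by (rule bergman_number_ge)
  qed
  ultimately show ?thesis
    by blast
qed

end
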